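(* Let $\Omega\subset\mathbb{R}^d$ be open and bounded, $\Gamma\subset\mathbb{R}^s$ compact, $U:=\Omega\times\Gamma$. Let $u\in C^1(\Omega,\Gamma)$ and let $(E,\mu)\in\mathcal{M}(U,\mathbb{R}^{d,s}\times\mathbb{R})$ with $\mu=\delta_u$ and $E=\nabla u\,\delta_u$ in the sense that $$\int_U\langle\phi,\mathrm{d}E\rangle=\int_\Omega\langle\phi(x,u(x)),\nabla u(x)\rangle\,\mathrm{d}x\qquad\forall\phi\in C_0(U,\mathbb{R}^{d,s}).$$ Then $(E,\mu)$ satisfies the first-order continuity equation $\nabla_x\mu+\operatorname{div}_zE=0$, i.e. $$\int_U\operatorname{div}_x\phi\,\mathrm{d}\mu+\int_U\langle\nabla_z\phi^{\top},\mathrm{d}E\rangle=0\qquad\forall\phi\in C_c^1(\Omega\times\Gamma,\mathbb{R}^d).$$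
   Context: Points of $U$ are written $(x,z)$ with $x\in\Omega$, $z\in\Gamma$; derivatives with index $x$ (resp. $z$) are taken with respect to the $\Omega$- (resp. $\Gamma$-) variable. $C_0(U,\mathbb{R}^k)$ is the closure in the supremum norm of the compactly supported continuous functions; $\mathcal{M}(U,\mathbb{R}^k)$ is the space of (finite) $\mathbb{R}^k$-valued Radon measures on $U$. The graph-concentrated measure $\delta_u$ is defined by $\int_U\phi\,\mathrm{d}\delta_u:=\int_\Omega\phi(x,u(x))\,\mathrm{d}x$ for all $\phi\in C_0(U,\mathbb{R})$. $\mathbb{R}^{d,s}$ denotes real $d\times s$ matrices with the Frobenius inner product; $(\nabla u)_{i,k}=\partial_{x_i}u_k$ and $(\nabla_z\phi^{\top})_{i,k}=\partial_{z_k}\phi_i$. $C_c^1(\Omega\times\Gamma,\mathbb{R}^d)$ denotes continuously differentiable functions with compact support in the first variable; concretely, functions $\phi$ of class $C^1$ on $\Omega\times\mathbb{R}^s$ for which there is a compact $K\subset\Omega$ with $\phi(x,z)=0$ for $x\notin K$, used on $\Omega\times\Gamma$. *)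

theory Defs
  imports "HOL-Analysis.Analysis"
begin

text \<open>
  The vector space of \<open>d \<times> s\<close> matrices is \<open>real^'s^'d\<close> (first index of type \<open>'d\<close>); its inner product
  as a Euclidean space is the Frobenius inner product. Points of \<open>\<Omega> \<times> \<Gamma>\<close> are pairs. Functions on a
  set \<open>U\<close> and set functions on the Borel sets of \<open>U\<close> are total functions whose other values are never used.
\<close>

subsection \<open>Function spaces\<close>

definition Cc :: "'a::topological_space set \<Rightarrow> ('a \<Rightarrow> 'b::real_normed_vector) set" where
  "Cc U = {\<phi>. continuous_on U \<phi> \<and> (\<exists>K. compact K \<and> K \<subseteq> U \<and> (\<forall>p\<in>U - K. \<phi> p = 0))}"

text \<open>Continuity and boundedness on \<open>U\<close> need not be required separately: both pass to uniform limits.\<close>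

definition C0 :: "'a::topological_space set \<Rightarrow> ('a \<Rightarrow> 'b::real_normed_vector) set" where
  "C0 U = {\<phi>. \<forall>e>0. \<exists>\<psi>\<in>Cc U. \<forall>p\<in>U. norm (\<phi> p - \<psi> p) < e}"

definition C1 :: "'a::real_normed_vector set \<Rightarrow> ('a \<Rightarrow> 'b::real_normed_vector) set" where
  "C1 S = {f. \<exists>f' :: 'a \<Rightarrow> 'a \<Rightarrow>\<^sub>L 'b.
      (\<forall>x\<in>S. (f has_derivative blinfun_apply (f' x)) (at x)) \<and> continuous_on S f'}"

text \<open>
  The test functions on \<open>\<Omega> \<times> \<Gamma>\<close> are \<open>C1\<close> on all of \<open>\<Omega> \<times> UNIV\<close>, with compact support in the first variable only.
\<close>

definition Cc1 :: "'a::real_normed_vector set \<Rightarrow> ('a \<times> 'c::real_normed_vector \<Rightarrow> 'b::real_normed_vector) set"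
  where
  "Cc1 \<Omega> = {\<phi>. \<phi> \<in> C1 (\<Omega> \<times> UNIV) \<and>
      (\<exists>K. compact K \<and> K \<subseteq> \<Omega> \<and> (\<forall>x\<in>\<Omega> - K. \<forall>z. \<phi> (x, z) = 0))}"

subsection \<open>Partial derivatives\<close>

definition partial_deriv :: "'a::real_normed_vector \<Rightarrow> ('a \<Rightarrow> real) \<Rightarrow> 'a \<Rightarrow> real" where
  "partial_deriv b f p = deriv (\<lambda>t. f (p + t *\<^sub>R b)) 0"

definition grad :: "(real^'d \<Rightarrow> real^'s) \<Rightarrow> real^'d \<Rightarrow> real^'s^'d" where
  "grad u x = (\<chi> i k. partial_deriv (axis i 1) (\<lambda>y. u y $ k) x)"

definition div_x :: "((real^'d) \<times> (real^'s) \<Rightarrow> real^'d) \<Rightarrow> (real^'d) \<times> (real^'s) \<Rightarrow> real" where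
  "div_x \<phi> p = (\<Sum>i\<in>UNIV. partial_deriv (axis i 1, 0) (\<lambda>q. \<phi> q $ i) p)"

definition grad_z_T :: "((real^'d) \<times> (real^'s) \<Rightarrow> real^'d) \<Rightarrow> (real^'d) \<times> (real^'s) \<Rightarrow> real^'s^'d" where
  "grad_z_T \<phi> p = (\<chi> i k. partial_deriv (0, axis k 1) (\<lambda>q. \<phi> q $ i) p)"

subsection \<open>Vector-valued Radon measures\<close>

text \<open>
  Finite vector-valued Radon measures on \<open>U\<close>: \<open>\<sigma>\<close>-additive set functions on the Borel sets of \<open>U\<close>
  (hence of finite total variation) that are inner regular. Regularity is expressed with the supremum
  of \<open>norm (E B)\<close> over the Borel subsets \<open>B\<close> of a set, which is comparable to the total variation of that set.
\<close>

definition radon_measures :: "'a::topological_space set \<Rightarrow> ('a set \<Rightarrow> 'b::euclidean_space) set" where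
  "radon_measures U = {E.
      (\<forall>A :: nat \<Rightarrow> 'a set. range A \<subseteq> sets (restrict_space borel U) \<longrightarrow> disjoint_family A \<longrightarrow>
         (\<lambda>i. E (A i)) sums E (\<Union>i. A i)) \<and>
      (\<forall>A\<in>sets (restrict_space borel U). \<forall>e>0. \<exists>K. compact K \<and> K \<subseteq> A \<and>
         K \<in> sets (restrict_space borel U) \<and>
         (\<forall>B\<in>sets (restrict_space borel U). B \<subseteq> A - K \<longrightarrow> norm (E B) < e))}"

text \<open>
  Integration against a signed measure uses its Jordan decomposition; the positive part of \<open>\<nu>\<close> is
  \<open>A \<mapsto> sup {\<nu> B | B \<subseteq> A Borel}\<close>, and the negative part is the positive part of \<open>-\<nu>\<close>.
  (\<open>ennreal\<close> sends negative values to \<open>0 = \<nu> {}\<close>, which does not change the supremum.)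
\<close>

definition upper_variation :: "'a::topological_space set \<Rightarrow> ('a set \<Rightarrow> real) \<Rightarrow> 'a measure" where
  "upper_variation U \<nu> = measure_of U (sets (restrict_space borel U))
     (\<lambda>A. SUP B\<in>{B \<in> sets (restrict_space borel U). B \<subseteq> A}. ennreal (\<nu> B))"

definition signed_integral :: "'a::topological_space set \<Rightarrow> ('a \<Rightarrow> real) \<Rightarrow> ('a set \<Rightarrow> real) \<Rightarrow> real" where
  "signed_integral U f \<nu> =
     (\<integral>p. f p \<partial>upper_variation U \<nu>) - (\<integral>p. f p \<partial>upper_variation U (\<lambda>A. - \<nu> A))"

text \<open>
  The integral of \<open>\<langle>\<phi>, dE\<rangle>\<close> over \<open>U\<close>, summing over components. For \<open>'b = real\<close>
  it is the integral of \<open>\<phi>\<close> against a signed measure.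
\<close>

definition vector_integral ::
  "'a::topological_space set \<Rightarrow> ('a \<Rightarrow> 'b::euclidean_space) \<Rightarrow> ('a set \<Rightarrow> 'b) \<Rightarrow> real" where
  "vector_integral U \<phi> E = (\<Sum>b\<in>Basis. signed_integral U (\<lambda>p. \<phi> p \<bullet> b) (\<lambda>A. E A \<bullet> b))"

text \<open>\<open>\<mu> = \<delta>\<^sub>u\<close>: among Radon measures, \<open>\<delta>\<^sub>u\<close> is the one determined by its integrals of \<open>C0\<close> functions.\<close>

definition is_graph_measure ::
  "(real^'d) set \<Rightarrow> (real^'s) set \<Rightarrow> (real^'d \<Rightarrow> real^'s) \<Rightarrow> (((real^'d) \<times> (real^'s)) set \<Rightarrow> real) \<Rightarrow> bool" where
  "is_graph_measure \<Omega> \<Gamma> u \<mu> \<longleftrightarrow>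
     (\<forall>\<phi>\<in>C0 (\<Omega> \<times> \<Gamma>). vector_integral (\<Omega> \<times> \<Gamma>) \<phi> \<mu> = (LINT x:\<Omega>|lborel. \<phi> (x, u x)))"

text \<open>
  \<open>E = \<nabla>u \<delta>\<^sub>u\<close>, for a Radon measure \<open>E\<close>.
  Integrability of \<open>\<nabla>u\<close> on \<open>\<Omega>\<close> is not a separate requirement: for bounded open \<open>\<Omega>\<close>,
  compact \<open>\<Gamma>\<close> and \<open>u\<close> of class \<open>C1\<close> it follows by testing with functions of compact support,
  because \<open>E\<close> has finite total variation; so the right-hand side is never a default value.
\<close>

definition is_grad_graph_measure ::
  "(real^'d) set \<Rightarrow> (real^'s) set \<Rightarrow> (real^'d \<Rightarrow> real^'s) \<Rightarrow> (((real^'d) \<times> (real^'s)) set \<Rightarrow> real^'s^'d) \<Rightarrow> bool"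
  where
  "is_grad_graph_measure \<Omega> \<Gamma> u E \<longleftrightarrow>
     (\<forall>\<phi>\<in>C0 (\<Omega> \<times> \<Gamma>).
        vector_integral (\<Omega> \<times> \<Gamma>) \<phi> E = (LINT x:\<Omega>|lborel. \<phi> (x, u x) \<bullet> grad u x))"

definition first_order_continuity_equation ::
  "(real^'d) set \<Rightarrow> (real^'s) set \<Rightarrow> (((real^'d) \<times> (real^'s)) set \<Rightarrow> real^'s^'d) \<Rightarrow>
   (((real^'d) \<times> (real^'s)) set \<Rightarrow> real) \<Rightarrow> bool" where
  "first_order_continuity_equation \<Omega> \<Gamma> E \<mu> \<longleftrightarrow>
     (\<forall>\<phi>\<in>Cc1 \<Omega>. vector_integral (\<Omega> \<times> \<Gamma>) (div_x \<phi>) \<mu> + vector_integral (\<Omega> \<times> \<Gamma>) (grad_z_T \<phi>) E = 0)"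

end

theory Submission imports Defs begin

text \<open>
  The partial derivatives of a test function \<open>\<phi>\<close> lie in \<open>Cc\<close>, so both integrals may be written over
  \<open>\<Omega>\<close>; by the chain rule their sum is the integral of the divergence of \<open>x \<mapsto> \<phi> (x, u x)\<close>.
  This field is \<open>C1\<close> with compact support in \<open>\<Omega>\<close>. The integral of a directional derivative of
  such a function vanishes: it is the limit of integrals of difference quotients, which are zero by
  translation invariance of the Lebesgue measure.
\<close>

section \<open>Vanishing integrals of derivatives of compactly supported functions\<close>

lemma has_derivative_eq_zero_off_support:
  fixes g :: "'a::real_normed_vector \<Rightarrow> 'b::real_normed_vector"
  assumes "(g has_derivative D) (at x)" and "open S" and "x \<in> S" and "\<And>y. y \<in> S \<Longrightarrow> g y = 0"
  shows "D = (\<lambda>v. 0)"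
proof -
  have "(g has_derivative (\<lambda>v. 0)) (at x)"
    by (rule has_derivative_transform_within_open[OF has_derivative_const assms(2,3)])
       (simp add: assms(4))
  then show ?thesis
    using assms(1) has_derivative_unique by blast
qed

text \<open>Continuity gives integrability on the compact set \<open>K\<close>, and the integrands
  over \<open>K\<close> and over \<open>\<Omega>\<close> coincide. So \<open>f\<close> is controlled
  near the boundary of \<open>\<Omega>\<close> by its support.\<close>

lemma set_integrable_compact_support:
  fixes f :: "'a::euclidean_space \<Rightarrow> real"
  assumes cont: "continuous_on \<Omega> f"
    and K: "compact K" "K \<subseteq> \<Omega>" and supp: "\<And>x. x \<in> \<Omega> - K \<Longrightarrow> f x = 0"
  shows "set_integrable lborel \<Omega> f"
proof -
  have "integrable lborel (\<lambda>x. indicator K x *\<^sub>R f x)"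
    using borel_integrable_compact[OF K(1) continuous_on_subset[OF cont K(2)]] by simp
  moreover have "(\<lambda>x. indicator K x *\<^sub>R f x) = (\<lambda>x. indicator \<Omega> x *\<^sub>R f x)"
    using K(2) supp by (auto simp: indicator_def fun_eq_iff)
  ultimately show ?thesis
    by (simp add: set_integrable_def)
qed

lemma lborel_integral_translate:
  fixes f :: "'a::euclidean_space \<Rightarrow> real"
  assumes "f \<in> borel_measurable borel"
  shows "(LINT x|lborel. f (x + a)) = (LINT x|lborel. f x)"
proof -
  have "(LINT x|lborel. f x) = (LINT x|distr lborel borel ((+) a). f x)"
    by (simp add: lborel_distr_plus)
  also have "\<dots> = (LINT x|lborel. f (a + x))"
    by (rule integral_distr) (use assms in auto)
  finally show ?thesis
    by (simp add: add.commute)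
qed

text \<open>The limit is justified by dominated convergence: the mean value theorem bounds all
  difference quotients by one constant, and all of them vanish outside one ball.\<close>

lemma integral_directional_derivative_eq_0:
  fixes g :: "'a::euclidean_space \<Rightarrow> real"
  assumes der: "\<And>x. (g has_derivative g' x) (at x)"
    and cont: "continuous_on UNIV (\<lambda>x. g' x e)"
    and K: "compact K" and supp: "\<And>x. x \<notin> K \<Longrightarrow> g x = 0"
  shows "(LINT x|lborel. g' x e) = 0"
proof -
  \<comment> \<open>Step sizes are positive, so that division by them is legitimate, and at most 1,
    so that every shift has length at most \<open>norm e\<close>.\<close>
  define t where "t = (\<lambda>n. 1 / real (Suc n))"
  have t: "t n > 0" "t n \<le> 1" for n
    by (auto simp: t_def)
  have t0: "t \<longlonglongrightarrow> 0"
    unfolding t_def by (rule LIMSEQ_Suc[OF lim_1_over_n])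
  define q where "q = (\<lambda>n x. (g (x + t n *\<^sub>R e) - g x) / t n)"
  have gc: "continuous_on UNIV g"
    using der has_derivative_continuous continuous_at_imp_continuous_on by blast
  then have gm: "g \<in> borel_measurable borel"
    by (rule borel_measurable_continuous_onI)
  have gi: "integrable lborel g"
    using set_integrable_compact_support[OF gc K] supp by (simp add: set_integrable_def)
  have gti: "integrable lborel (\<lambda>x. g (x + a))" for a
  proof -
    have "integrable (distr lborel borel ((+) a)) g"
      using gi by (simp add: lborel_distr_plus)
    then show ?thesis
      by (subst (asm) integrable_distr_eq) (use gm in \<open>auto simp: add.commute\<close>)
  qed
  have q0: "(LINT x|lborel. q n x) = 0" for n
    unfolding q_def using gi gti[of "t n *\<^sub>R e"] lborel_integral_translate[OF gm, of "t n *\<^sub>R e"] by simp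
  have lin: "((\<lambda>s. g (x + s *\<^sub>R e)) has_real_derivative g' (x + s *\<^sub>R e) e) (at s)" for x s
  proof -
    have "((\<lambda>s. x + s *\<^sub>R e) has_derivative (\<lambda>h. h *\<^sub>R e)) (at s)"
      by (auto intro!: derivative_eq_intros)
    from has_derivative_compose[OF this der]
    show ?thesis
      using linear_cmul[OF has_derivative_linear[OF der]]
      by (auto simp: has_field_derivative_def fun_eq_iff elim!: has_derivative_eq_rhs)
  qed
  have off: "g' x e = 0" if "x \<notin> K" for x
    using has_derivative_eq_zero_off_support[OF der, of "- K" x] that supp compact_imp_closed[OF K]
    by (auto simp: open_Compl)
  have "bounded ((\<lambda>x. g' x e) ` K)"
    by (intro compact_imp_bounded compact_continuous_image continuous_on_subset[OF cont] K) auto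
  then obtain M where M: "M > 0" "\<And>x. x \<in> K \<Longrightarrow> \<bar>g' x e\<bar> \<le> M"
    by (auto simp: bounded_pos)
  \<comment> \<open>The bound on \<open>K\<close> is global because the derivative vanishes off
    \<open>K\<close>.\<close>
  then have M': "\<bar>g' x e\<bar> \<le> M" for x
    using off[of x] by (cases "x \<in> K") auto
  obtain R where R: "\<And>x. x \<in> K \<Longrightarrow> norm x \<le> R"
    using compact_imp_bounded[OF K] by (auto simp: bounded_iff)
  \<comment> \<open>Outside this enlarged ball both \<open>x\<close> and its shift avoid
    \<open>K\<close>, so the quotient is zero; inside it, the quotient is a value of the directional
    derivative.\<close>
  have bound: "norm (q n x) \<le> M * indicator (cball 0 (R + norm e)) x" for n x
  proof (cases "x \<in> cball 0 (R + norm e)")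
    case True
    obtain s where "g (x + t n *\<^sub>R e) - g (x + 0 *\<^sub>R e) = (t n - 0) * g' (x + s *\<^sub>R e) e"
      using MVT2[of 0 "t n" "\<lambda>s. g (x + s *\<^sub>R e)" "\<lambda>s. g' (x + s *\<^sub>R e) e"] lin t(1) by blast
    then have "q n x = g' (x + s *\<^sub>R e) e"
      using t(1)[of n] by (simp add: q_def)
    then show ?thesis
      using True M' by simp
  next
    case False
    have "norm (t n *\<^sub>R e) \<le> norm e"
      using t[of n] by (simp add: mult_left_le_one_le)
    then have "norm x > R" "norm (x + t n *\<^sub>R e) > R"
      using False norm_triangle_ineq4[of "x + t n *\<^sub>R e" "t n *\<^sub>R e"] norm_ge_zero[of e]
      unfolding mem_cball_0 add_diff_cancel_right' by linarith+
    then have "x \<notin> K" "x + t n *\<^sub>R e \<notin> K"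
      using R not_le by blast+
    then show ?thesis
      using supp M(1) by (simp add: q_def)
  qed
  have "(\<lambda>n. LINT x|lborel. q n x) \<longlonglongrightarrow> (LINT x|lborel. g' x e)"
  proof (rule integral_dominated_convergence[where w = "\<lambda>x. M * indicator (cball 0 (R + norm e)) x"])
    show "(\<lambda>x. g' x e) \<in> borel_measurable lborel"
      using borel_measurable_continuous_onI[OF cont] by simp
    show "q n \<in> borel_measurable lborel" for n
      unfolding q_def using gm by measurable
    show "integrable lborel (\<lambda>x. M * indicator (cball 0 (R + norm e)) x :: real)"
      by (intro integrable_mult_right integrable_real_indicator)
         (use emeasure_lborel_cball_finite in auto)
    show "AE x in lborel. (\<lambda>n. q n x) \<longlonglongrightarrow> g' x e"
    proof (rule AE_I2)
      fix x
      have "((\<lambda>h. (g (x + h *\<^sub>R e) - g x) / h) \<longlongrightarrow> g' x e) (at 0)"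
        using lin[of x 0] by (simp add: DERIV_def)
      \<comment> \<open>The filter \<open>at 0\<close> excludes 0 itself, hence convergence of
        \<open>t\<close> is combined with \<open>t n\<close> being nonzero.\<close>
      moreover have "filterlim t (at 0) sequentially"
        using t0 by (simp add: filterlim_at t_def)
      ultimately show "(\<lambda>n. q n x) \<longlonglongrightarrow> g' x e"
        unfolding q_def by (rule filterlim_compose)
    qed
  qed (use bound in auto)
  then show ?thesis
    using q0 LIMSEQ_unique[OF tendsto_const] by fastforce
qed

text \<open>Extension by zero reduces this to the whole space. Smoothness survives because the open
  sets \<open>\<Omega>\<close> and \<open>- K\<close> cover everything, and the extension is zero on
  the second.\<close>

lemma set_integral_directional_derivative_eq_0:
  fixes g :: "'a::euclidean_space \<Rightarrow> real"
  assumes "open \<Omega>" and der: "\<And>x. x \<in> \<Omega> \<Longrightarrow> (g has_derivative g' x) (at x)"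
    and cont: "continuous_on \<Omega> (\<lambda>x. g' x e)"
    and K: "compact K" "K \<subseteq> \<Omega>" and supp: "\<And>x. x \<in> \<Omega> - K \<Longrightarrow> g x = 0"
  shows "(LINT x:\<Omega>|lborel. g' x e) = 0"
proof -
  define G where "G = (\<lambda>x. if x \<in> \<Omega> then g x else 0)"
  define G' where "G' = (\<lambda>x v. if x \<in> \<Omega> then g' x v else 0)"
  have opK: "open (- K)"
    using K(1) compact_imp_closed by (auto simp: open_Compl)
  have derG: "(G has_derivative G' x) (at x)" for x
  proof (cases "x \<in> \<Omega>")
    case True
    show ?thesis
      by (rule has_derivative_transform_within_open[OF _ \<open>open \<Omega>\<close>])
         (use True der[OF True] in \<open>auto simp: G_def G'_def\<close>)
  next
    case False
    show ?thesis
      by (rule has_derivative_transform_within_open[OF _ opK, of "\<lambda>_. 0"])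
         (use False supp K(2) in \<open>auto simp: G_def G'_def\<close>)
  qed
  have G0: "G x = 0" if "x \<notin> K" for x
    using that supp by (auto simp: G_def)
  have off: "G' x = (\<lambda>v. 0)" if "x \<in> - K" for x
    using has_derivative_eq_zero_off_support[OF derG opK that] G0 by auto
  have "continuous_on (\<Omega> \<union> - K) (\<lambda>x. G' x e)"
  proof (rule continuous_on_open_Un[OF \<open>open \<Omega>\<close> opK])
    show "continuous_on \<Omega> (\<lambda>x. G' x e)"
      using cont by (rule continuous_on_eq) (simp add: G'_def)
    show "continuous_on (- K) (\<lambda>x. G' x e)"
      by (rule continuous_on_eq[of _ "\<lambda>_. 0"]) (auto simp: off)
  qed
  moreover have "\<Omega> \<union> - K = UNIV"
    using K(2) by auto
  ultimately have "(LINT x|lborel. G' x e) = 0"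
    using integral_directional_derivative_eq_0[OF derG _ K(1) G0] by auto
  moreover have "(\<lambda>x. indicator \<Omega> x *\<^sub>R g' x e) = (\<lambda>x. G' x e)"
    by (auto simp: G'_def indicator_def)
  ultimately show ?thesis
    by (simp add: set_lebesgue_integral_def)
qed

section \<open>Partial derivatives and admissible test functions\<close>

lemma partial_deriv_eq:
  assumes "(f has_derivative D) (at p)"
  shows "partial_deriv b f p = D b"
proof -
  have "((\<lambda>t. p + t *\<^sub>R b) has_derivative (\<lambda>t. t *\<^sub>R b)) (at 0)"
    by (auto intro!: derivative_eq_intros)
  moreover have "(f has_derivative D) (at (p + 0 *\<^sub>R b))"
    using assms by simp
  ultimately have "((\<lambda>t. f (p + t *\<^sub>R b)) has_derivative (\<lambda>t. D (t *\<^sub>R b))) (at 0)"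
    by (rule has_derivative_compose)
  then have "((\<lambda>t. f (p + t *\<^sub>R b)) has_real_derivative D b) (at 0)"
    using linear_cmul[OF has_derivative_linear[OF assms]]
    by (auto simp: has_field_derivative_def fun_eq_iff elim!: has_derivative_eq_rhs)
  then show ?thesis
    unfolding partial_deriv_def by (rule DERIV_imp_deriv)
qed

lemma Cc_subset_C0: "Cc U \<subseteq> C0 U"
  unfolding C0_def by force

text \<open>As \<open>\<Gamma>\<close> is compact, \<open>K \<times> \<Gamma>\<close> is a compact
  support inside the product; no decay towards the boundary of \<open>\<Gamma>\<close> is
  involved.\<close>

lemma Cc_product_compactI:
  assumes "continuous_on (\<Omega> \<times> \<Gamma>) f" and "compact K" and "K \<subseteq> \<Omega>" and "compact \<Gamma>"
    and "\<And>x z. x \<in> \<Omega> - K \<Longrightarrow> f (x, z) = 0"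
  shows "f \<in> Cc (\<Omega> \<times> \<Gamma>)"
  unfolding Cc_def using assms by (auto intro!: exI[of _ "K \<times> \<Gamma>"] compact_Times)

section \<open>The continuity equation for measures concentrated on a graph\<close>

theorem proposition14:
  fixes \<Omega> :: "(real^'d) set" and \<Gamma> :: "(real^'s) set"
    and u :: "real^'d \<Rightarrow> real^'s"
    and E :: "((real^'d) \<times> (real^'s)) set \<Rightarrow> real^'s^'d"
    and \<mu> :: "((real^'d) \<times> (real^'s)) set \<Rightarrow> real"
  assumes "open \<Omega>" and "bounded \<Omega>" and "compact \<Gamma>"
    and "u \<in> C1 \<Omega>" and "u ` \<Omega> \<subseteq> \<Gamma>"
    and "(\<lambda>A. (E A, \<mu> A)) \<in> radon_measures (\<Omega> \<times> \<Gamma>)"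
    and "is_graph_measure \<Omega> \<Gamma> u \<mu>"
    and "is_grad_graph_measure \<Omega> \<Gamma> u E"
  shows "first_order_continuity_equation \<Omega> \<Gamma> E \<mu>"
  unfolding first_order_continuity_equation_def
proof
  fix \<phi> :: "(real^'d) \<times> (real^'s) \<Rightarrow> real^'d"
  assume "\<phi> \<in> Cc1 \<Omega>"
  then obtain \<phi>' K where
      \<phi>': "\<And>p. p \<in> \<Omega> \<times> UNIV \<Longrightarrow> (\<phi> has_derivative blinfun_apply (\<phi>' p)) (at p)"
    and \<phi>'c: "continuous_on (\<Omega> \<times> UNIV) \<phi>'"
    and K: "compact K" "K \<subseteq> \<Omega>" and supp: "\<And>x z. x \<in> \<Omega> - K \<Longrightarrow> \<phi> (x, z) = 0"
    unfolding Cc1_def C1_def by blast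
  obtain u' where u': "\<And>x. x \<in> \<Omega> \<Longrightarrow> (u has_derivative blinfun_apply (u' x)) (at x)"
    and u'c: "continuous_on \<Omega> u'"
    using \<open>u \<in> C1 \<Omega>\<close> unfolding C1_def by blast
  have uc: "continuous_on \<Omega> u"
    by (meson u' has_derivative_continuous continuous_at_imp_continuous_on)
  \<comment> \<open>An open set on which \<open>\<phi>\<close> vanishes is needed to conclude that
    its derivative vanishes there too.\<close>
  have opK: "open ((\<Omega> - K) \<times> (UNIV :: (real^'s) set))"
    using \<open>open \<Omega>\<close> K(1) by (intro open_Times) (auto simp: compact_imp_closed open_Diff)
  have \<phi>'0: "\<phi>' (x, z) v = 0" if "x \<in> \<Omega> - K" for x z v
    using has_derivative_eq_zero_off_support[OF \<phi>' opK, of "(x, z)"] that supp by auto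
  have \<phi>'i: "((\<lambda>q. \<phi> q $ i) has_derivative (\<lambda>v. \<phi>' p v $ i)) (at p)" if "p \<in> \<Omega> \<times> UNIV" for p i
    using bounded_linear.has_derivative[OF bounded_linear_vec_nth \<phi>'[OF that]] .
  have div: "div_x \<phi> p = (\<Sum>i\<in>UNIV. \<phi>' p (axis i 1, 0) $ i)" if "p \<in> \<Omega> \<times> UNIV" for p
    unfolding div_x_def using partial_deriv_eq[OF \<phi>'i[OF that]] by simp
  have gradz: "grad_z_T \<phi> p = (\<chi> i k. \<phi>' p (0, axis k 1) $ i)" if "p \<in> \<Omega> \<times> UNIV" for p
    unfolding grad_z_T_def using partial_deriv_eq[OF \<phi>'i[OF that]] by simp
  have gradu: "grad u x $ i $ k = u' x (axis i 1) $ k" if "x \<in> \<Omega>" for x i k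
    unfolding grad_def
    using partial_deriv_eq[OF bounded_linear.has_derivative[OF bounded_linear_vec_nth u'[OF that]]]
    by simp
  have \<phi>'cv: "continuous_on (\<Omega> \<times> UNIV) (\<lambda>p. \<phi>' p v)" for v
    using \<phi>'c by (intro continuous_intros)

  \<comment> \<open>Continuity of expressions built from \<open>deriv\<close> is inherited from
    their formulas in terms of \<open>\<phi>'\<close> and \<open>u'\<close>.\<close>
  have divc: "continuous_on (\<Omega> \<times> UNIV) (div_x \<phi>)"
    by (rule continuous_on_eq[of _ "\<lambda>p. \<Sum>i\<in>UNIV. \<phi>' p (axis i 1, 0) $ i"])
       (auto simp: div intro!: continuous_intros \<phi>'cv)
  have gradzc: "continuous_on (\<Omega> \<times> UNIV) (grad_z_T \<phi>)"
    by (rule continuous_on_eq[of _ "\<lambda>p. \<chi> i k. \<phi>' p (0, axis k 1) $ i"])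
       (auto simp: gradz intro!: continuous_intros \<phi>'cv)
  have gradc: "continuous_on \<Omega> (grad u)"
    by (rule continuous_on_eq[of _ "\<lambda>x. \<chi> i k. u' x (axis i 1) $ k"])
       (auto simp: gradu vec_eq_iff intro!: continuous_intros u'c)
  have div0: "div_x \<phi> (x, z) = 0" and gradz0: "grad_z_T \<phi> (x, z) = 0" if "x \<in> \<Omega> - K" for x z
    using that by (auto simp: div gradz \<phi>'0 vec_eq_iff)
  have "div_x \<phi> \<in> Cc (\<Omega> \<times> \<Gamma>)" and "grad_z_T \<phi> \<in> Cc (\<Omega> \<times> \<Gamma>)"
    by (rule Cc_product_compactI[OF continuous_on_subset[OF divc] K \<open>compact \<Gamma>\<close> div0], blast+)
       (rule Cc_product_compactI[OF continuous_on_subset[OF gradzc] K \<open>compact \<Gamma>\<close> gradz0], blast+)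
  then have "vector_integral (\<Omega> \<times> \<Gamma>) (div_x \<phi>) \<mu> = (LINT x:\<Omega>|lborel. div_x \<phi> (x, u x))"
    and "vector_integral (\<Omega> \<times> \<Gamma>) (grad_z_T \<phi>) E = (LINT x:\<Omega>|lborel. grad_z_T \<phi> (x, u x) \<bullet> grad u x)"
    using Cc_subset_C0 assms(7,8) unfolding is_graph_measure_def is_grad_graph_measure_def by blast+
  moreover have "(LINT x:\<Omega>|lborel. div_x \<phi> (x, u x)) + (LINT x:\<Omega>|lborel. grad_z_T \<phi> (x, u x) \<bullet> grad u x)
      = (LINT x:\<Omega>|lborel. div_x \<phi> (x, u x) + grad_z_T \<phi> (x, u x) \<bullet> grad u x)"
  \<comment> \<open>Additivity requires both integrands to be integrable; the factor supported in
    \<open>K\<close> ensures this even if \<open>grad u\<close> is unbounded near the boundary of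
    \<open>\<Omega>\<close>.\<close>
  proof (rule set_integral_add(2)[symmetric])
    show "set_integrable lborel \<Omega> (\<lambda>x. div_x \<phi> (x, u x))"
      using K div0
      by (intro set_integrable_compact_support[of _ _ K] continuous_on_compose2[OF divc])
         (auto intro!: continuous_intros uc)
    show "set_integrable lborel \<Omega> (\<lambda>x. grad_z_T \<phi> (x, u x) \<bullet> grad u x)"
      using K gradz0
      by (intro set_integrable_compact_support[of _ _ K] continuous_on_inner gradc
            continuous_on_compose2[OF gradzc])
         (auto intro!: continuous_intros uc)
  qed
  \<comment> \<open>Each summand is the derivative of the \<open>i\<close>-th component of
    \<open>x \<mapsto> \<phi> (x, u x)\<close> in direction \<open>axis i 1\<close>. Splitting the
    direction into its two factors yields the divergence and the Frobenius product.\<close>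
  moreover have "\<dots> = (LINT x:\<Omega>|lborel. \<Sum>i\<in>UNIV. \<phi>' (x, u x) (axis i 1, u' x (axis i 1)) $ i)"
  proof (rule set_lebesgue_integral_cong)
    show "\<Omega> \<in> sets lborel"
      using \<open>open \<Omega>\<close> by simp
    have "\<phi>' (x, u x) (axis i 1, u' x (axis i 1)) =
        \<phi>' (x, u x) (axis i 1, 0) + (\<Sum>k\<in>UNIV. u' x (axis i 1) $ k *\<^sub>R \<phi>' (x, u x) (0, axis k 1))" for x i
    proof -
      \<comment> \<open>Expanding the second factor in the standard basis lets linearity of
        \<open>\<phi>'\<close> produce the partial derivatives in \<open>z\<close>.\<close>
      have "(0, w) = (\<Sum>k\<in>UNIV. w $ k *\<^sub>R (0 :: real^'d, axis k 1))" for w :: "real^'s"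
        by (auto simp: prod_eq_iff fst_sum snd_sum vec_eq_iff axis_def if_distrib cong: if_cong)
      then have lin: "\<phi>' p (0, w) = (\<Sum>k\<in>UNIV. w $ k *\<^sub>R \<phi>' p (0, axis k 1))" for w p
        by (metis (no_types, lifting) blinfun.scaleR_right blinfun.sum_right sum.cong)
      have "\<phi>' (x, u x) (axis i 1, w) = \<phi>' (x, u x) (axis i 1, 0) + \<phi>' (x, u x) (0, w)" for w
        by (simp flip: blinfun.add_right)
      then show ?thesis
        by (rule trans) (simp only: lin[of _ "u' x (axis i 1)"])
    qed
    then show "\<forall>x. x \<in> \<Omega> \<longrightarrow> div_x \<phi> (x, u x) + grad_z_T \<phi> (x, u x) \<bullet> grad u x =
        (\<Sum>i\<in>UNIV. \<phi>' (x, u x) (axis i 1, u' x (axis i 1)) $ i)"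
      by (simp add: div gradz gradu inner_vec_def sum.distrib mult.commute)
  qed
  moreover have "\<dots> = (\<Sum>i\<in>UNIV. LINT x:\<Omega>|lborel. \<phi>' (x, u x) (axis i 1, u' x (axis i 1)) $ i)"
    and "(LINT x:\<Omega>|lborel. \<phi>' (x, u x) (axis i 1, u' x (axis i 1)) $ i) = 0" for i
  proof -
    have cont: "continuous_on \<Omega> (\<lambda>x. \<phi>' (x, u x) (axis i 1, u' x (axis i 1)) $ i)" for i
      by (intro continuous_intros continuous_on_compose2[OF \<phi>'c] uc u'c) auto
    have int: "set_integrable lborel \<Omega> (\<lambda>x. \<phi>' (x, u x) (axis i 1, u' x (axis i 1)) $ i)" for i
      using K \<phi>'0 by (intro set_integrable_compact_support[of _ _ K] cont) auto
    then show "(LINT x:\<Omega>|lborel. \<Sum>i\<in>UNIV. \<phi>' (x, u x) (axis i 1, u' x (axis i 1)) $ i)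
        = (\<Sum>i\<in>UNIV. LINT x:\<Omega>|lborel. \<phi>' (x, u x) (axis i 1, u' x (axis i 1)) $ i)"
      unfolding set_lebesgue_integral_def set_integrable_def scaleR_sum_right
      by (intro Bochner_Integration.integral_sum)
    show "(LINT x:\<Omega>|lborel. \<phi>' (x, u x) (axis i 1, u' x (axis i 1)) $ i) = 0"
    \<comment> \<open>The support of this composite lies in \<open>K\<close> for any
      \<open>u\<close>, since \<open>\<phi>\<close> vanishes for all \<open>z\<close> once
      \<open>x\<close> is outside \<open>K\<close>.\<close>
    proof (rule set_integral_directional_derivative_eq_0[where g = "\<lambda>x. \<phi> (x, u x) $ i"
          and g' = "\<lambda>x v. \<phi>' (x, u x) (v, u' x v) $ i", OF \<open>open \<Omega>\<close> _ cont K])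
      fix x assume "x \<in> \<Omega>"
      then have "((\<lambda>x. (x, u x)) has_derivative (\<lambda>v. (v, u' x v))) (at x)"
        by (intro has_derivative_Pair has_derivative_ident u')
      then show "((\<lambda>x. \<phi> (x, u x) $ i) has_derivative (\<lambda>v. \<phi>' (x, u x) (v, u' x v) $ i)) (at x)"
        by (rule has_derivative_compose) (use \<phi>'i \<open>x \<in> \<Omega>\<close> in auto)
    qed (use supp in auto)
  qed
  ultimately show "vector_integral (\<Omega> \<times> \<Gamma>) (div_x \<phi>) \<mu> + vector_integral (\<Omega> \<times> \<Gamma>) (grad_z_T \<phi>) E = 0"
    by simp
qed

end
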